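(* Let $\mathbf A$ be an MV-algebra and $s:\mathbf A\to[0,1]$ a state on $\mathbf A$. Then the following conditions are equivalent: (a) $s$ is a morphism of MV-algebras (into the standard MV-algebra $[0,1]$); (b) $s(x\wedge x')=s(x)\wedge s(x)'$ for all $x\in A$; (c) $s(x)\odot s(x)=s(x\odot x)$ for all $x\in A$; (d) $s(x\wedge y)=s(x)\wedge s(y)$ for all $x,y\in A$.
   Context: An MV-algebra $(A,\oplus,\neg,0)$ has $1=\neg 0$, $x\odot y=\neg(\neg x\oplus\neg y)$, order $x\le y$ iff $\neg x\oplus y=1$, and lattice operations $x\vee y=\neg(\neg x\oplus y)\oplus y$, $x\wedge y=\neg(\neg x\vee\neg y)$. The notation $x'$ means $\neg x$. The standard MV-algebra is $[0,1]$ with $a\oplus b=\min(1,a+b)$, $a'=\neg a=1-a$, $a\odot b=\max(0,a+b-1)$, $a\wedge b=\min(a,b)$. A morphism of MV-algebras is a map preserving $\oplus,\odot,\neg,0,1$. A state on $\mathbf A$ is a map $s:\mathbf A\to[0,1]$ with $s(1)=1$ and $s(x\oplus y)=s(x)+s(y)$ whenever $x\odot y=0$. *)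

theory Defs
  imports Complex_Main "HOL-Algebra.Congruence"
begin

record 'a mv_structure = "'a partial_object" +
  mv_plus :: "'a \<Rightarrow> 'a \<Rightarrow> 'a"  (infixl \<open>\<oplus>\<index>\<close> 65)
  mv_neg :: "'a \<Rightarrow> 'a"  (\<open>\<^bold>\<not>\<index> _\<close> [81] 80)
  mv_zero :: 'a  (\<open>\<zero>\<index>\<close>)

locale mv_algebra =
  fixes A :: "('a, 'm) mv_structure_scheme"  (structure)
  assumes plus_closed: "\<lbrakk>x \<in> carrier A; y \<in> carrier A\<rbrakk> \<Longrightarrow> x \<oplus> y \<in> carrier A"
    and neg_closed: "x \<in> carrier A \<Longrightarrow> \<^bold>\<not> x \<in> carrier A"
    and zero_closed: "\<zero> \<in> carrier A"
    and plus_assoc: "\<lbrakk>x \<in> carrier A; y \<in> carrier A; z \<in> carrier A\<rbrakk>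
      \<Longrightarrow> (x \<oplus> y) \<oplus> z = x \<oplus> (y \<oplus> z)"
    and plus_commute: "\<lbrakk>x \<in> carrier A; y \<in> carrier A\<rbrakk> \<Longrightarrow> x \<oplus> y = y \<oplus> x"
    and plus_zero: "x \<in> carrier A \<Longrightarrow> x \<oplus> \<zero> = x"
    and neg_neg: "x \<in> carrier A \<Longrightarrow> \<^bold>\<not> (\<^bold>\<not> x) = x"
    and plus_neg_zero: "x \<in> carrier A \<Longrightarrow> x \<oplus> \<^bold>\<not> \<zero> = \<^bold>\<not> \<zero>"
    and lukasiewicz: "\<lbrakk>x \<in> carrier A; y \<in> carrier A\<rbrakk>
      \<Longrightarrow> \<^bold>\<not> (\<^bold>\<not> x \<oplus> y) \<oplus> y = \<^bold>\<not> (\<^bold>\<not> y \<oplus> x) \<oplus> x"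

definition mv_one :: "('a, 'm) mv_structure_scheme \<Rightarrow> 'a"  (\<open>\<one>\<index>\<close>)
  where "\<one>\<^bsub>A\<^esub> = \<^bold>\<not>\<^bsub>A\<^esub> \<zero>\<^bsub>A\<^esub>"

definition mv_mult :: "('a, 'm) mv_structure_scheme \<Rightarrow> 'a \<Rightarrow> 'a \<Rightarrow> 'a"  (infixl \<open>\<odot>\<index>\<close> 70)
  where "x \<odot>\<^bsub>A\<^esub> y = \<^bold>\<not>\<^bsub>A\<^esub> (\<^bold>\<not>\<^bsub>A\<^esub> x \<oplus>\<^bsub>A\<^esub> \<^bold>\<not>\<^bsub>A\<^esub> y)"

definition mv_join :: "('a, 'm) mv_structure_scheme \<Rightarrow> 'a \<Rightarrow> 'a \<Rightarrow> 'a"  (infixl \<open>\<squnion>\<index>\<close> 65)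
  where "x \<squnion>\<^bsub>A\<^esub> y = \<^bold>\<not>\<^bsub>A\<^esub> (\<^bold>\<not>\<^bsub>A\<^esub> x \<oplus>\<^bsub>A\<^esub> y) \<oplus>\<^bsub>A\<^esub> y"

definition mv_meet :: "('a, 'm) mv_structure_scheme \<Rightarrow> 'a \<Rightarrow> 'a \<Rightarrow> 'a"  (infixl \<open>\<sqinter>\<index>\<close> 70)
  where "x \<sqinter>\<^bsub>A\<^esub> y = \<^bold>\<not>\<^bsub>A\<^esub> (\<^bold>\<not>\<^bsub>A\<^esub> x \<squnion>\<^bsub>A\<^esub> \<^bold>\<not>\<^bsub>A\<^esub> y)"

definition mv_hom ::
    "('a, 'm) mv_structure_scheme \<Rightarrow> ('b, 'n) mv_structure_scheme \<Rightarrow> ('a \<Rightarrow> 'b) set"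
  where "mv_hom A B = {f.
      (\<forall>x\<in>carrier A. f x \<in> carrier B) \<and>
      (\<forall>x\<in>carrier A. \<forall>y\<in>carrier A. f (x \<oplus>\<^bsub>A\<^esub> y) = f x \<oplus>\<^bsub>B\<^esub> f y) \<and>
      (\<forall>x\<in>carrier A. \<forall>y\<in>carrier A. f (x \<odot>\<^bsub>A\<^esub> y) = f x \<odot>\<^bsub>B\<^esub> f y) \<and>
      (\<forall>x\<in>carrier A. f (\<^bold>\<not>\<^bsub>A\<^esub> x) = \<^bold>\<not>\<^bsub>B\<^esub> f x) \<and>
      f \<zero>\<^bsub>A\<^esub> = \<zero>\<^bsub>B\<^esub> \<and> f \<one>\<^bsub>A\<^esub> = \<one>\<^bsub>B\<^esub>}"

definition std_mv :: "real mv_structure"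
  where "std_mv = \<lparr>carrier = {0..1}, mv_plus = (\<lambda>a b. min 1 (a + b)),
    mv_neg = (\<lambda>a. 1 - a), mv_zero = 0\<rparr>"

text \<open>The addition on the right-hand side of the last conjunct is that of the reals, not
  truncated addition.\<close>

definition mv_state :: "('a, 'm) mv_structure_scheme \<Rightarrow> ('a \<Rightarrow> real) \<Rightarrow> bool"
  where "mv_state A s \<longleftrightarrow>
      (\<forall>x\<in>carrier A. s x \<in> {0..1}) \<and>
      s \<one>\<^bsub>A\<^esub> = 1 \<and>
      (\<forall>x\<in>carrier A. \<forall>y\<in>carrier A. x \<odot>\<^bsub>A\<^esub> y = \<zero>\<^bsub>A\<^esub> \<longrightarrow> s (x \<oplus>\<^bsub>A\<^esub> y) = s x + s y)"

lemma std_mv_simps: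
  "carrier std_mv = {0..1}"
  "a \<oplus>\<^bsub>std_mv\<^esub> b = min 1 (a + b)"
  "\<^bold>\<not>\<^bsub>std_mv\<^esub> a = 1 - a"
  "\<zero>\<^bsub>std_mv\<^esub> = 0"
  "\<one>\<^bsub>std_mv\<^esub> = 1"
  "a \<odot>\<^bsub>std_mv\<^esub> b = max 0 (a + b - 1)"
  by (auto simp: std_mv_def mv_one_def mv_mult_def)

lemma std_mv_join:
  "\<lbrakk>a \<in> {0..1}; b \<in> {0..1}\<rbrakk> \<Longrightarrow> a \<squnion>\<^bsub>std_mv\<^esub> b = max a b"
  by (auto simp: mv_join_def std_mv_simps)

lemma std_mv_meet:
  "\<lbrakk>a \<in> {0..1}; b \<in> {0..1}\<rbrakk> \<Longrightarrow> a \<sqinter>\<^bsub>std_mv\<^esub> b = min a b"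
  by (auto simp: mv_meet_def std_mv_join std_mv_simps(3))

lemma mv_algebra_std_mv: "mv_algebra std_mv"
  by unfold_locales (auto simp: std_mv_simps min_def)

end

theory Submission
  imports Defs
begin

text \<open>
  A state is additive only on orthogonal elements. Since every \<open>c \<le> w\<close> splits \<open>w\<close> into the
  orthogonal parts \<open>c\<close> and \<open>w \<odot> \<not>c\<close>, this already yields \<open>s (\<not>x) = 1 - s x\<close>,
  \<open>s (x \<sqinter> y) = s x - s (x \<odot> \<not>y)\<close> and \<open>s (x \<oplus> y) + s (x \<odot> y) = s x + s y\<close>. By these
  identities, the values of \<open>s\<close> on meets, on products and on sums determine each other, so that
  preserving binary meets is the same as being a morphism, and the condition on \<open>x \<sqinter> \<not>x\<close> is the
  same as the condition on \<open>x \<odot> x\<close>.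

  The substance is that preserving squares forces \<open>s\<close> to preserve all meets. The defects
  \<open>s x - s (x \<sqinter> y)\<close> and \<open>s y - s (x \<sqinter> y)\<close> are the values of \<open>s\<close> at \<open>x \<odot> \<not>y\<close> and \<open>y \<odot> \<not>x\<close>,
  so it suffices that one of these values is zero. The two elements are disjoint (prelinearity),
  and disjointness of \<open>a\<close> and \<open>b\<close>, in the form \<open>b \<odot> \<not>a = b\<close>, survives replacing \<open>a\<close> by
  \<open>a \<oplus> a\<close>. If \<open>s\<close> preserves squares, then dually \<open>s (a \<oplus> a) = min 1 (2 * s a)\<close>. Hence, if
  \<open>s a > 0\<close>, iterated doubling reaches an element \<open>u\<close> with \<open>s u = 1\<close> and \<open>b \<odot> \<not>u = b\<close>, and
  \<open>s b \<le> s (\<not>u) = 0\<close>.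
\<close>

section \<open>Arithmetic of MV-algebras\<close>

context mv_algebra
begin

lemma mult_closed: "x \<in> carrier A \<Longrightarrow> y \<in> carrier A \<Longrightarrow> x \<odot> y \<in> carrier A"
  by (simp add: mv_mult_def plus_closed neg_closed)

lemma one_closed: "\<one> \<in> carrier A"
  by (simp add: mv_one_def neg_closed zero_closed)

lemmas closed = plus_closed neg_closed zero_closed mult_closed one_closed

lemma neg_mult: "x \<in> carrier A \<Longrightarrow> y \<in> carrier A \<Longrightarrow> \<^bold>\<not> (x \<odot> y) = \<^bold>\<not> x \<oplus> \<^bold>\<not> y"
  by (simp add: mv_mult_def neg_neg closed)

lemma neg_plus: "x \<in> carrier A \<Longrightarrow> y \<in> carrier A \<Longrightarrow> \<^bold>\<not> (x \<oplus> y) = \<^bold>\<not> x \<odot> \<^bold>\<not> y"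
  by (simp add: mv_mult_def neg_neg closed)

lemma neg_zero: "\<^bold>\<not> \<zero> = \<one>"
  by (simp add: mv_one_def)

lemma neg_one: "\<^bold>\<not> \<one> = \<zero>"
  by (simp add: mv_one_def neg_neg closed)

lemma mult_commute: "x \<in> carrier A \<Longrightarrow> y \<in> carrier A \<Longrightarrow> x \<odot> y = y \<odot> x"
  by (simp add: mv_mult_def plus_commute closed)

lemma mult_assoc:
  "x \<in> carrier A \<Longrightarrow> y \<in> carrier A \<Longrightarrow> z \<in> carrier A \<Longrightarrow> (x \<odot> y) \<odot> z = x \<odot> (y \<odot> z)"
  by (simp add: mv_mult_def neg_neg closed plus_assoc)

lemma mult_left_commute:
  "x \<in> carrier A \<Longrightarrow> y \<in> carrier A \<Longrightarrow> z \<in> carrier A \<Longrightarrow> x \<odot> (y \<odot> z) = y \<odot> (x \<odot> z)"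
  by (metis mult_assoc mult_commute)

lemma plus_left_commute:
  "x \<in> carrier A \<Longrightarrow> y \<in> carrier A \<Longrightarrow> z \<in> carrier A \<Longrightarrow> x \<oplus> (y \<oplus> z) = y \<oplus> (x \<oplus> z)"
  by (metis plus_assoc plus_commute)

lemma zero_plus: "x \<in> carrier A \<Longrightarrow> \<zero> \<oplus> x = x"
  by (metis plus_commute plus_zero zero_closed)

lemma plus_one: "x \<in> carrier A \<Longrightarrow> x \<oplus> \<one> = \<one>"
  by (simp add: mv_one_def plus_neg_zero)

lemma neg_plus_self: "x \<in> carrier A \<Longrightarrow> \<^bold>\<not> x \<oplus> x = \<one>"
  using lukasiewicz[of "\<^bold>\<not> \<zero>" x] plus_neg_zero[of "\<^bold>\<not> x"]
  by (simp add: closed neg_neg zero_plus plus_one neg_zero neg_one)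

lemma mult_neg_self: "x \<in> carrier A \<Longrightarrow> x \<odot> \<^bold>\<not> x = \<zero>"
  using neg_plus_self[of x] by (simp add: mv_mult_def neg_neg neg_one)

lemma mult_zero: "x \<in> carrier A \<Longrightarrow> x \<odot> \<zero> = \<zero>"
  by (simp add: mv_mult_def neg_zero plus_one neg_one closed)

lemma meet_eq: "x \<in> carrier A \<Longrightarrow> y \<in> carrier A \<Longrightarrow> x \<sqinter> y = x \<odot> (\<^bold>\<not> x \<oplus> y)"
  using lukasiewicz[of "\<^bold>\<not> x" "\<^bold>\<not> y"]
  by (simp add: mv_meet_def mv_join_def mv_mult_def neg_neg closed plus_commute)

lemma meet_commute: "x \<in> carrier A \<Longrightarrow> y \<in> carrier A \<Longrightarrow> x \<sqinter> y = y \<sqinter> x"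
  using lukasiewicz[of "\<^bold>\<not> x" "\<^bold>\<not> y"]
  by (simp add: mv_meet_def mv_join_def neg_neg closed)

lemma meet_eq_mult_neg:
  "x \<in> carrier A \<Longrightarrow> y \<in> carrier A \<Longrightarrow> x \<sqinter> y = x \<odot> \<^bold>\<not> (x \<odot> \<^bold>\<not> y)"
  by (simp add: meet_eq neg_mult neg_neg closed)

lemma meet_closed: "x \<in> carrier A \<Longrightarrow> y \<in> carrier A \<Longrightarrow> x \<sqinter> y \<in> carrier A"
  by (simp add: meet_eq closed)

text \<open>
  Both sides are the join of \<open>c\<close> and \<open>w\<close>, the third hypothesis being \<open>c \<le> w\<close>. The two summands
  on the left are orthogonal, so a state is additive on them.
\<close>
lemma relative_complement_plus:
  assumes "c \<in> carrier A" "w \<in> carrier A" "\<^bold>\<not> c \<oplus> w = \<one>"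
  shows "(w \<odot> \<^bold>\<not> c) \<oplus> c = w"
  using lukasiewicz[of w c] assms by (simp add: mv_mult_def neg_neg neg_one zero_plus)

lemma mult_le_left:
  assumes "x \<in> carrier A" "y \<in> carrier A"
  shows "\<^bold>\<not> (x \<odot> y) \<oplus> x = \<one>"
  using assms neg_plus_self[of x] plus_left_commute[of "\<^bold>\<not> x" "\<^bold>\<not> y" x]
  by (simp add: neg_mult plus_assoc closed plus_one)

lemma le_plus_left:
  assumes "x \<in> carrier A" "y \<in> carrier A"
  shows "\<^bold>\<not> x \<oplus> (x \<oplus> y) = \<one>"
  using assms neg_plus_self[of x] plus_assoc[of "\<^bold>\<not> x" x y] plus_commute[of "\<one>" y]
  by (simp add: closed plus_one)

text \<open>
  Prelinearity. Applying commutativity of the meet three times brings a factor \<open>x\<close> into a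
  product that also contains \<open>\<not>x\<close>.
\<close>
lemma mult_neg_meet_mult_neg:
  assumes x: "x \<in> carrier A" and y: "y \<in> carrier A"
  shows "(x \<odot> \<^bold>\<not> y) \<sqinter> (y \<odot> \<^bold>\<not> x) = \<zero>"
proof -
  define b where "b = y \<odot> \<^bold>\<not> x"
  define z where "z = \<^bold>\<not> x \<oplus> b"
  define w where "w = x \<odot> (\<^bold>\<not> y \<oplus> x)"
  have b: "b \<in> carrier A" and z: "z \<in> carrier A" and w: "w \<in> carrier A"
    using x y by (simp_all add: b_def z_def w_def closed)
  have swap: "p \<odot> (\<^bold>\<not> p \<oplus> q) = q \<odot> (\<^bold>\<not> q \<oplus> p)" if "p \<in> carrier A" "q \<in> carrier A" for p q
    using that meet_commute[of p q] by (simp add: meet_eq)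
  have neg_z: "\<^bold>\<not> z = w"
    using x y b by (simp add: z_def w_def b_def neg_plus neg_mult neg_neg closed)
  have factor: "w \<odot> q = x \<odot> ((\<^bold>\<not> y \<oplus> x) \<odot> q)" if "q \<in> carrier A" for q
    using x y that by (simp add: w_def mult_assoc closed)
  have "(x \<odot> \<^bold>\<not> y) \<sqinter> b = (x \<odot> \<^bold>\<not> y) \<odot> ((\<^bold>\<not> x \<oplus> y) \<oplus> b)"
    using x y b by (simp add: meet_eq neg_mult neg_neg closed)
  also have "(\<^bold>\<not> x \<oplus> y) \<oplus> b = y \<oplus> z"
    using x y b by (simp add: z_def closed plus_assoc plus_left_commute)
  also have "(x \<odot> \<^bold>\<not> y) \<odot> (y \<oplus> z) = x \<odot> (\<^bold>\<not> y \<odot> (\<^bold>\<not> (\<^bold>\<not> y) \<oplus> z))"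
    using x y z by (simp add: mult_assoc neg_neg closed)
  also have "\<dots> = x \<odot> (z \<odot> (\<^bold>\<not> z \<oplus> \<^bold>\<not> y))"
    using x y z swap[of "\<^bold>\<not> y" z] by (simp add: closed)
  also have "\<dots> = (x \<odot> (\<^bold>\<not> x \<oplus> b)) \<odot> (w \<oplus> \<^bold>\<not> y)"
    using x y z w by (simp add: neg_z mult_assoc closed flip: z_def)
  also have "\<dots> = (b \<odot> (\<^bold>\<not> b \<oplus> x)) \<odot> (\<^bold>\<not> y \<oplus> w)"
    using x y b w swap[of x b] plus_commute[of w "\<^bold>\<not> y"] by (simp add: closed)
  also have "\<dots> = (\<^bold>\<not> b \<oplus> x) \<odot> (\<^bold>\<not> x \<odot> (y \<odot> (\<^bold>\<not> y \<oplus> w)))"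
    using x y b w
    by (simp add: b_def mult_assoc mult_commute mult_left_commute closed)
  also have "\<dots> = (\<^bold>\<not> b \<oplus> x) \<odot> (\<^bold>\<not> x \<odot> (w \<odot> (\<^bold>\<not> w \<oplus> y)))"
    using y w swap[of y w] by simp
  also have "\<^bold>\<not> x \<odot> (w \<odot> (\<^bold>\<not> w \<oplus> y)) = (x \<odot> \<^bold>\<not> x) \<odot> ((\<^bold>\<not> y \<oplus> x) \<odot> (\<^bold>\<not> w \<oplus> y))"
    using x y w by (simp add: factor mult_assoc mult_left_commute[of "\<^bold>\<not> x" x] closed)
  also have "(\<^bold>\<not> b \<oplus> x) \<odot> \<dots> = \<zero>"
    using x y b w mult_commute[of "\<zero>" "(\<^bold>\<not> y \<oplus> x) \<odot> (\<^bold>\<not> w \<oplus> y)"]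
    by (simp add: mult_neg_self mult_zero closed)
  finally show ?thesis by (simp add: b_def)
qed

text \<open>Disjointness as a fixed-point equation: in this form it is stable under doubling.\<close>
lemma mult_neg_eq_if_meet_zero:
  assumes "a \<in> carrier A" "b \<in> carrier A" "b \<sqinter> a = \<zero>"
  shows "b \<odot> \<^bold>\<not> a = b"
  using relative_complement_plus[of "b \<odot> \<^bold>\<not> a" b] mult_le_left[of b "\<^bold>\<not> a"] assms
    meet_eq_mult_neg[of b a]
  by (simp add: closed zero_plus)

lemma mult_neg_eq_doubling:
  assumes "a \<in> carrier A" "b \<in> carrier A" "b \<odot> \<^bold>\<not> a = b"
  shows "b \<odot> \<^bold>\<not> (((\<lambda>z. z \<oplus> z) ^^ n) a) = b \<and> ((\<lambda>z. z \<oplus> z) ^^ n) a \<in> carrier A"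
  using assms by (induction n) (simp_all add: neg_plus closed flip: mult_assoc)

end

section \<open>States\<close>

locale mv_algebra_state = mv_algebra +
  fixes s
  assumes state: "mv_state A s"
begin

lemma state_nonneg: "x \<in> carrier A \<Longrightarrow> 0 \<le> s x"
  and state_le_one: "x \<in> carrier A \<Longrightarrow> s x \<le> 1"
  and state_one: "s \<one> = 1"
  and state_plus_orthogonal:
    "x \<in> carrier A \<Longrightarrow> y \<in> carrier A \<Longrightarrow> x \<odot> y = \<zero> \<Longrightarrow> s (x \<oplus> y) = s x + s y"
  using state by (auto simp: mv_state_def)

lemma state_relative_complement:
  assumes "c \<in> carrier A" "w \<in> carrier A" "\<^bold>\<not> c \<oplus> w = \<one>"
  shows "s (w \<odot> \<^bold>\<not> c) = s w - s c"
proof -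
  have "(w \<odot> \<^bold>\<not> c) \<odot> c = \<zero>"
    using assms
    by (simp add: mult_assoc mult_commute[of "\<^bold>\<not> c" c] mult_neg_self mult_zero closed)
  then show ?thesis
    using state_plus_orthogonal[of "w \<odot> \<^bold>\<not> c" c] relative_complement_plus[OF assms] assms
    by (simp add: closed)
qed

lemma state_neg: "x \<in> carrier A \<Longrightarrow> s (\<^bold>\<not> x) = 1 - s x"
  using state_plus_orthogonal[of x "\<^bold>\<not> x"] plus_commute[of x "\<^bold>\<not> x"]
  by (simp add: mult_neg_self neg_plus_self state_one closed)

lemma state_zero: "s \<zero> = 0"
  using state_neg[of "\<one>"] by (simp add: neg_one state_one closed)

lemma state_meet:
  assumes "x \<in> carrier A" "y \<in> carrier A"
  shows "s (x \<sqinter> y) = s x - s (x \<odot> \<^bold>\<not> y)"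
  using assms state_relative_complement[of "x \<odot> \<^bold>\<not> y" x] mult_le_left[of x "\<^bold>\<not> y"]
  by (simp add: meet_eq_mult_neg closed)

lemma state_mult:
  assumes "x \<in> carrier A" "y \<in> carrier A"
  shows "s (x \<odot> y) = s x - s (x \<sqinter> \<^bold>\<not> y)"
  using assms state_meet[of x "\<^bold>\<not> y"] by (simp add: neg_neg closed)

text \<open>The part of \<open>x \<oplus> y\<close> above \<open>x\<close> is \<open>\<not>x \<sqinter> y\<close>, and the rest of \<open>y\<close> is \<open>x \<odot> y\<close>.\<close>
lemma state_plus:
  assumes "x \<in> carrier A" "y \<in> carrier A"
  shows "s (x \<oplus> y) = s x + s y - s (x \<odot> y)"
proof -
  have "s (x \<oplus> y) - s x = s ((x \<oplus> y) \<odot> \<^bold>\<not> x)"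
    using assms state_relative_complement[of x "x \<oplus> y"] le_plus_left[of x y]
    by (simp add: closed)
  also have "(x \<oplus> y) \<odot> \<^bold>\<not> x = y \<sqinter> \<^bold>\<not> x"
    using assms meet_commute[of y "\<^bold>\<not> x"]
    by (simp add: meet_eq[of "\<^bold>\<not> x"] neg_neg mult_commute closed)
  also have "s (y \<sqinter> \<^bold>\<not> x) = s y - s (x \<odot> y)"
    using assms by (simp add: state_meet neg_neg mult_commute closed)
  finally show ?thesis by simp
qed

lemma state_mult_le_right:
  assumes "x \<in> carrier A" "y \<in> carrier A"
  shows "s (x \<odot> y) \<le> s y"
  using assms state_mult[of y x] state_nonneg[of "y \<sqinter> \<^bold>\<not> x"]
  by (simp add: mult_commute[of x y] meet_closed closed)

section \<open>States that preserve squares\<close>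

text \<open>
  The law for squares, applied to \<open>\<not>x\<close>, is a law for doubling. The truncation at \<open>1\<close> does no
  harm to the iteration, since \<open>min 1 (2 * min 1 t) = min 1 (2 * t)\<close> for \<open>t \<ge> 0\<close>.
\<close>
lemma state_doubling:
  assumes square: "\<And>x. x \<in> carrier A \<Longrightarrow> s (x \<odot> x) = max 0 (2 * s x - 1)"
    and a: "a \<in> carrier A"
  shows "((\<lambda>z. z \<oplus> z) ^^ n) a \<in> carrier A \<and> s (((\<lambda>z. z \<oplus> z) ^^ n) a) = min 1 (2 ^ n * s a)"
proof (induction n)
  case 0
  then show ?case using a state_le_one[of a] by simp
next
  case (Suc n)
  define u where "u = ((\<lambda>z. z \<oplus> z) ^^ n) a"
  have u: "u \<in> carrier A" and su: "s u = min 1 (2 ^ n * s a)"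
    using Suc by (auto simp: u_def)
  have "s (u \<oplus> u) = min 1 (2 * s u)"
    using state_plus[OF u u] square[OF u] by simp
  then show ?case
    using u su state_nonneg[OF a] by (simp add: closed min_def flip: u_def)
qed

lemma state_zero_of_disjoint:
  assumes square: "\<And>x. x \<in> carrier A \<Longrightarrow> s (x \<odot> x) = max 0 (2 * s x - 1)"
    and a: "a \<in> carrier A" and b: "b \<in> carrier A"
    and disjoint: "a \<sqinter> b = \<zero>"
  shows "s a = 0 \<or> s b = 0"
proof (rule ccontr)
  assume "\<not> ?thesis"
  then have pos: "s a > 0" "s b > 0"
    using state_nonneg[OF a] state_nonneg[OF b] by auto
  obtain n where "1 / s a < 2 ^ n"
    using real_arch_pow[of 2 "1 / s a"] by auto
  then have large: "2 ^ n * s a \<ge> 1"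
    using pos by (simp add: field_simps)
  define u where "u = ((\<lambda>z. z \<oplus> z) ^^ n) a"
  have u: "u \<in> carrier A" and su: "s u = 1"
    using state_doubling[OF square a, of n] large by (auto simp: u_def)
  have "b \<odot> \<^bold>\<not> a = b"
    using mult_neg_eq_if_meet_zero[OF a b] disjoint meet_commute[OF a b] by simp
  then have "b \<odot> \<^bold>\<not> u = b"
    using mult_neg_eq_doubling[OF a b, of n] by (simp add: u_def)
  then have "s b \<le> s (\<^bold>\<not> u)"
    using state_mult_le_right[of b "\<^bold>\<not> u"] b u by (simp add: closed)
  then show False
    using su pos state_neg[OF u] by simp
qed

lemma state_meet_of_square:
  assumes square: "\<And>x. x \<in> carrier A \<Longrightarrow> s (x \<odot> x) = max 0 (2 * s x - 1)"
    and x: "x \<in> carrier A" and y: "y \<in> carrier A"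
  shows "s (x \<sqinter> y) = min (s x) (s y)"
proof -
  have "s (x \<odot> \<^bold>\<not> y) = 0 \<or> s (y \<odot> \<^bold>\<not> x) = 0"
    using state_zero_of_disjoint[OF square, of "x \<odot> \<^bold>\<not> y" "y \<odot> \<^bold>\<not> x"] x y
      mult_neg_meet_mult_neg[OF x y] by (simp add: closed)
  moreover have "s (x \<odot> \<^bold>\<not> y) \<ge> 0" "s (y \<odot> \<^bold>\<not> x) \<ge> 0"
    using x y by (simp_all add: state_nonneg closed)
  ultimately show ?thesis
    using state_meet[OF x y] state_meet[OF y x] meet_commute[OF x y] by auto
qed

section \<open>Characterisations of state morphisms\<close>

lemma meet_neg_iff_square:
  assumes x: "x \<in> carrier A"
  shows "s (x \<sqinter> \<^bold>\<not> x) = min (s x) (1 - s x) \<longleftrightarrow> s (x \<odot> x) = max 0 (2 * s x - 1)"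
  using state_mult[OF x x] by auto

lemma hom_std_iff_meet:
  "s \<in> mv_hom A std_mv \<longleftrightarrow>
    (\<forall>x\<in>carrier A. \<forall>y\<in>carrier A. s (x \<sqinter> y) = min (s x) (s y))"
proof
  assume hom: "s \<in> mv_hom A std_mv"
  show "\<forall>x\<in>carrier A. \<forall>y\<in>carrier A. s (x \<sqinter> y) = min (s x) (s y)"
  proof (intro ballI)
    fix x y assume x: "x \<in> carrier A" and y: "y \<in> carrier A"
    have "s (x \<odot> \<^bold>\<not> y) = max 0 (s x + s (\<^bold>\<not> y) - 1)"
      using hom x y by (simp add: mv_hom_def std_mv_simps closed)
    then show "s (x \<sqinter> y) = min (s x) (s y)"
      using state_meet[OF x y] state_neg[OF y] by auto
  qed
next
  assume meet: "\<forall>x\<in>carrier A. \<forall>y\<in>carrier A. s (x \<sqinter> y) = min (s x) (s y)"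
  have mult: "s (x \<odot> y) = max 0 (s x + s y - 1)" if "x \<in> carrier A" "y \<in> carrier A" for x y
    using that meet state_mult[of x y] state_neg[of y] by (auto simp: closed)
  have plus: "s (x \<oplus> y) = min 1 (s x + s y)" if "x \<in> carrier A" "y \<in> carrier A" for x y
    using that state_plus[of x y] mult[of x y] by auto
  show "s \<in> mv_hom A std_mv"
    by (simp add: mv_hom_def std_mv_simps mult plus state_neg state_zero state_one
        state_nonneg state_le_one)
qed

lemma hom_std_iff_square:
  "s \<in> mv_hom A std_mv \<longleftrightarrow> (\<forall>x\<in>carrier A. s (x \<odot> x) = max 0 (2 * s x - 1))"
proof
  assume "s \<in> mv_hom A std_mv"
  then show "\<forall>x\<in>carrier A. s (x \<odot> x) = max 0 (2 * s x - 1)"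
    by (simp add: mv_hom_def std_mv_simps)
next
  assume "\<forall>x\<in>carrier A. s (x \<odot> x) = max 0 (2 * s x - 1)"
  then show "s \<in> mv_hom A std_mv"
    using state_meet_of_square by (simp add: hom_std_iff_meet)
qed

end

theorem proposition4:
  fixes A :: "('a, 'm) mv_structure_scheme" and s :: "'a \<Rightarrow> real"
  assumes "mv_algebra A" and "mv_state A s"
  shows "(s \<in> mv_hom A std_mv \<longleftrightarrow>
      (\<forall>x\<in>carrier A. s (x \<sqinter>\<^bsub>A\<^esub> \<^bold>\<not>\<^bsub>A\<^esub> x) = s x \<sqinter>\<^bsub>std_mv\<^esub> \<^bold>\<not>\<^bsub>std_mv\<^esub> (s x)))
    \<and> (s \<in> mv_hom A std_mv \<longleftrightarrow>
      (\<forall>x\<in>carrier A. s x \<odot>\<^bsub>std_mv\<^esub> s x = s (x \<odot>\<^bsub>A\<^esub> x)))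
    \<and> (s \<in> mv_hom A std_mv \<longleftrightarrow>
      (\<forall>x\<in>carrier A. \<forall>y\<in>carrier A. s (x \<sqinter>\<^bsub>A\<^esub> y) = s x \<sqinter>\<^bsub>std_mv\<^esub> s y))"
proof -
  interpret mv_algebra_state A s
    using assms by (simp add: mv_algebra_state_def mv_algebra_state_axioms_def)
  have unit: "s x \<in> {0..1}" if "x \<in> carrier A" for x
    using that by (simp add: state_nonneg state_le_one)
  have b: "s x \<sqinter>\<^bsub>std_mv\<^esub> \<^bold>\<not>\<^bsub>std_mv\<^esub> (s x) = min (s x) (1 - s x)" if "x \<in> carrier A" for x
    using unit[OF that] by (simp add: std_mv_meet std_mv_simps)
  have c: "s x \<odot>\<^bsub>std_mv\<^esub> s x = max 0 (2 * s x - 1)" for x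
    by (simp add: std_mv_simps)
  have d: "s x \<sqinter>\<^bsub>std_mv\<^esub> s y = min (s x) (s y)" if "x \<in> carrier A" "y \<in> carrier A" for x y
    using std_mv_meet[OF unit unit] that by blast
  have "s \<in> mv_hom A std_mv \<longleftrightarrow>
      (\<forall>x\<in>carrier A. s (x \<sqinter>\<^bsub>A\<^esub> \<^bold>\<not>\<^bsub>A\<^esub> x) = s x \<sqinter>\<^bsub>std_mv\<^esub> \<^bold>\<not>\<^bsub>std_mv\<^esub> (s x))"
    by (simp add: b meet_neg_iff_square hom_std_iff_square)
  moreover have "s \<in> mv_hom A std_mv \<longleftrightarrow>
      (\<forall>x\<in>carrier A. s x \<odot>\<^bsub>std_mv\<^esub> s x = s (x \<odot>\<^bsub>A\<^esub> x))"
    by (simp only: c hom_std_iff_square eq_commute)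
  moreover have "s \<in> mv_hom A std_mv \<longleftrightarrow>
      (\<forall>x\<in>carrier A. \<forall>y\<in>carrier A. s (x \<sqinter>\<^bsub>A\<^esub> y) = s x \<sqinter>\<^bsub>std_mv\<^esub> s y)"
    by (simp add: d hom_std_iff_meet)
  ultimately show ?thesis by blast
qed

end
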